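(* Let $(\mathfrak{g},\alpha,\omega)$ be a three-dimensional cosymplectic real Lie algebra. Then $\mathfrak{g}$ is isomorphic to one of the following Lie algebras (given on a basis $e_1,e_2,e_3$ by their non-zero brackets) equipped with a cosymplectic structure of the indicated form, with real coefficients: (1) $\mathfrak{g}_{2.1}\oplus\mathfrak{g}_1$ (decomposable solvable, Bianchi III): $[e_1,e_2]=e_1$, with $\alpha=a_2e^2+a_3e^3$, $\omega=a_{12}e^{12}+a_{23}e^{23}$, $a_3a_{12}\neq0$; (2) $\mathfrak{g}_{3.1}$ (Weyl algebra, nilpotent, Bianchi II): $[e_2,e_3]=e_1$, with $\alpha=a_2e^2+a_3e^3$, $\omega=a_{12}e^{12}+a_{13}e^{13}+a_{23}e^{23}$, $a_3a_{12}-a_2a_{13}\neq0$; (3) $\mathfrak{g}_{3.4}^{-1}$ (solvable, Bianchi VI, $a=-1$): $[e_1,e_3]=e_1$, $[e_2,e_3]=-e_2$, with $\alpha=a_3e^3$, $\omega=a_{12}e^{12}+a_{13}e^{13}+a_{23}e^{23}$, $a_3a_{12}\neq0$; (4) $\mathfrak{g}_{3.5}^{0}$ (solvable, Bianchi VII, $\beta=0$): $[e_1,e_3]=-e_2$, $[e_2,e_3]=e_1$, with $\alpha=a_3e^3$, $\omega=a_{12}e^{12}+a_{13}e^{13}+a_{23}e^{23}$, $a_3a_{12}\neq0$.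
   Context: A cosymplectic Lie algebra $(\mathfrak{g},\alpha,\omega)$ is a real Lie algebra of dimension $2n+1$ with $\alpha\in\mathfrak{g}^*$ and $\omega\in\wedge^2\mathfrak{g}^*$ such that $\alpha([x,y])=0$ and $\omega([x,y],z)+\omega([y,z],x)+\omega([z,x],y)=0$ for all $x,y,z\in\mathfrak{g}$, and $\alpha\wedge\omega^n\neq0$; the pair $(\alpha,\omega)$ is then called a cosymplectic structure on $\mathfrak{g}$. $\{e^i\}$ denotes the dual basis of $\{e_i\}$ and $e^{ij}=e^i\wedge e^j$.
   Formalization: The Lie algebra is additionally assumed to be non-abelian: the abelian algebra R^3 with α=e^3, ω=e^12 is cosymplectic but is isomorphic to none of the four listed algebras, so the statement fails for it as written. *)

theory Defs
  imports "HOL-Analysis.Analysis"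
begin

locale lie_algebra =
  fixes br :: "'g::real_vector \<Rightarrow> 'g \<Rightarrow> 'g"
  assumes br_bilinear: "bilinear br"
    and br_alternating: "br x x = 0"
    and br_jacobi: "br x (br y z) + br y (br z x) + br z (br x y) = 0"

definition abelian_bracket :: "('g::real_vector \<Rightarrow> 'g \<Rightarrow> 'g) \<Rightarrow> bool" where
  "abelian_bracket br \<longleftrightarrow> (\<forall>x y. br x y = 0)"

text \<open>
  A \<open>p\<close>-form is encoded as a function of a sequence of vectors which looks only at the entries
  \<open>0, \<dots>, p - 1\<close>. The normalisation of the wedge product is the one for which
  \<open>(f \<and> g)(x, y) = f(x) g(y) - f(y) g(x)\<close> on covectors.
\<close>

type_synonym 'g form = "(nat \<Rightarrow> 'g) \<Rightarrow> real"

definition wedge :: "nat \<Rightarrow> nat \<Rightarrow> 'g form \<Rightarrow> 'g form \<Rightarrow> 'g form" where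
  "wedge p q f g = (\<lambda>v.
     (\<Sum>\<sigma> | \<sigma> permutes {..<p + q}. of_int (sign \<sigma>) * f (\<lambda>i. v (\<sigma> i)) * g (\<lambda>i. v (\<sigma> (p + i))))
       / (fact p * fact q))"

fun wedge_power :: "nat \<Rightarrow> 'g form \<Rightarrow> nat \<Rightarrow> 'g form" where
  "wedge_power p f 0 = (\<lambda>v. 1)"
| "wedge_power p f (Suc k) = wedge p (p * k) f (wedge_power p f k)"

definition form1 :: "('g \<Rightarrow> real) \<Rightarrow> 'g form" where
  "form1 \<alpha> = (\<lambda>v. \<alpha> (v 0))"

definition form2 :: "('g \<Rightarrow> 'g \<Rightarrow> real) \<Rightarrow> 'g form" where
  "form2 \<omega> = (\<lambda>v. \<omega> (v 0) (v 1))"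

lemma wedge_1_1_form1:
  "wedge 1 1 (form1 f) (form1 g) v = f (v 0) * g (v 1) - f (v 1) * g (v 0)"
proof -
  have s: "{..<1 + 1} = {0, 1::nat}" by auto
  have f: "finite {1::nat}" "(0::nat) \<notin> {1}" by auto
  show ?thesis
    unfolding wedge_def form1_def s sum_over_permutations_insert[OF f] permutes_sing
    by (simp add: sign_swap_id sign_id)
qed

lemma wedge_1_2_form:
  assumes alt: "\<And>x y. \<omega> y x = - \<omega> x y"
  shows "wedge 1 2 (form1 \<alpha>) (wedge_power 2 (form2 \<omega>) 1) v =
    \<alpha> (v 0) * \<omega> (v 1) (v 2) + \<alpha> (v 1) * \<omega> (v 2) (v 0) + \<alpha> (v 2) * \<omega> (v 0) (v 1)"
proof -
  have s2: "{..<2 + 2 * 0} = {0, 1::nat}" and s3: "{..<1 + 2} = {0, 1, 2::nat}" by auto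
  have f: "finite {1::nat}" "(0::nat) \<notin> {1}" and g: "finite {2::nat}" "(1::nat) \<notin> {2}"
    "finite {1,2::nat}" "(0::nat) \<notin> {1,2}" by auto
  have p: "wedge_power 2 (form2 \<omega>) 1 v = \<omega> (v 0) (v 1)" for v
    unfolding One_nat_def wedge_power.simps wedge_def form2_def s2[simplified One_nat_def]
     sum_over_permutations_insert[OF f, simplified One_nat_def] permutes_sing
    using alt[of "v 0" "v 1"]
    by (simp add: sign_swap_id sign_id)
  show ?thesis
    unfolding wedge_def form1_def p s3 sum_over_permutations_insert[OF g(3,4)] sum_over_permutations_insert[OF g(1,2)] permutes_sing
    using alt[of "v 0" "v 1"] alt[of "v 2" "v 0"] alt[of "v 1" "v 2"]
    by (simp add: sign_swap_id sign_id sign_compose permutation_swap_id permutation_compose Transposition.transpose_def numeral_2_eq_2)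
qed

text \<open>Since \<open>dim\<close> is \<open>0\<close> for infinite-dimensional spaces, \<open>dim_eq\<close> includes finite-dimensionality.\<close>

locale cosymplectic_lie_algebra = lie_algebra br
  for n :: nat and br :: "'g::real_vector \<Rightarrow> 'g \<Rightarrow> 'g" +
  fixes \<alpha> :: "'g \<Rightarrow> real" and \<omega> :: "'g \<Rightarrow> 'g \<Rightarrow> real"
  assumes dim_eq: "dim (UNIV :: 'g set) = 2 * n + 1"
    and \<alpha>_linear: "linear \<alpha>"
    and \<omega>_bilinear: "bilinear \<omega>"
    and \<omega>_alternating: "\<omega> x x = 0"
    and \<alpha>_closed: "\<alpha> (br x y) = 0"
    and \<omega>_closed: "\<omega> (br x y) z + \<omega> (br y z) x + \<omega> (br z x) y = 0"
    and nondegenerate: "wedge 1 (2 * n) (form1 \<alpha>) (wedge_power 2 (form2 \<omega>) n) \<noteq> (\<lambda>v. 0)"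

definition lie_iso ::
  "('g::real_vector \<Rightarrow> 'g \<Rightarrow> 'g) \<Rightarrow> ('h::real_vector \<Rightarrow> 'h \<Rightarrow> 'h) \<Rightarrow> ('g \<Rightarrow> 'h) \<Rightarrow> bool" where
  "lie_iso br br' \<phi> \<longleftrightarrow> linear \<phi> \<and> bij \<phi> \<and> (\<forall>x y. \<phi> (br x y) = br' (\<phi> x) (\<phi> y))"

text \<open>Isomorphism of Lie algebras carrying a 1-form and a 2-form.\<close>

definition cosymplectic_isomorphic ::
  "('g::real_vector \<Rightarrow> 'g \<Rightarrow> 'g) \<Rightarrow> ('g \<Rightarrow> real) \<Rightarrow> ('g \<Rightarrow> 'g \<Rightarrow> real) \<Rightarrow>
   ('h::real_vector \<Rightarrow> 'h \<Rightarrow> 'h) \<Rightarrow> ('h \<Rightarrow> real) \<Rightarrow> ('h \<Rightarrow> 'h \<Rightarrow> real) \<Rightarrow> bool" where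
  "cosymplectic_isomorphic br \<alpha> \<omega> br' \<alpha>' \<omega>' \<longleftrightarrow>
     (\<exists>\<phi>. lie_iso br br' \<phi> \<and>
          (\<forall>x. \<alpha> x = \<alpha>' (\<phi> x)) \<and> (\<forall>x y. \<omega> x y = \<omega>' (\<phi> x) (\<phi> y)))"

abbreviation eb :: "3 \<Rightarrow> real ^ 3" where
  "eb i \<equiv> axis i 1"

definition ed :: "3 \<Rightarrow> real ^ 3 \<Rightarrow> real" where
  "ed i = (\<lambda>x. x $ i)"

definition ed2 :: "3 \<Rightarrow> 3 \<Rightarrow> real ^ 3 \<Rightarrow> real ^ 3 \<Rightarrow> real" where
  "ed2 i j = (\<lambda>x y. ed i x * ed j y - ed i y * ed j x)"

lemma ed2_eq_wedge: "form2 (ed2 i j) = wedge 1 1 (form1 (ed i)) (form1 (ed j))"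
  by (rule ext, subst wedge_1_1_form1) (simp add: form2_def ed2_def mult.commute)

text \<open>
  The alternating bilinear bracket on \<open>\<real>\<^sup>3\<close> with
  \<open>[e\<^sub>1, e\<^sub>2] = u\<close>, \<open>[e\<^sub>1, e\<^sub>3] = v\<close> and \<open>[e\<^sub>2, e\<^sub>3] = w\<close>.
\<close>

definition bracket3 :: "real ^ 3 \<Rightarrow> real ^ 3 \<Rightarrow> real ^ 3 \<Rightarrow> real ^ 3 \<Rightarrow> real ^ 3 \<Rightarrow> real ^ 3" where
  "bracket3 u v w = (\<lambda>x y. ed2 1 2 x y *\<^sub>R u + ed2 1 3 x y *\<^sub>R v + ed2 2 3 x y *\<^sub>R w)"

lemma bracket3_eb [simp]:
  "bracket3 u v w (eb 1) (eb 2) = u" "bracket3 u v w (eb 1) (eb 3) = v" "bracket3 u v w (eb 2) (eb 3) = w"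
  by (simp_all add: bracket3_def ed2_def ed_def axis_def)

text \<open>\<open>g34\<close> and \<open>g35\<close> are the members of the families \<open>\<gg>\<^sub>3\<^sub>.\<^sub>4\<close> and \<open>\<gg>\<^sub>3\<^sub>.\<^sub>5\<close> with parameter \<open>-1\<close> and \<open>0\<close>.\<close>

definition g21_g1 :: "real ^ 3 \<Rightarrow> real ^ 3 \<Rightarrow> real ^ 3" where
  "g21_g1 = bracket3 (eb 1) 0 0"

definition g31 :: "real ^ 3 \<Rightarrow> real ^ 3 \<Rightarrow> real ^ 3" where
  "g31 = bracket3 0 0 (eb 1)"

definition g34 :: "real ^ 3 \<Rightarrow> real ^ 3 \<Rightarrow> real ^ 3" where
  "g34 = bracket3 0 (eb 1) (- eb 2)"

definition g35 :: "real ^ 3 \<Rightarrow> real ^ 3 \<Rightarrow> real ^ 3" where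
  "g35 = bracket3 0 (- eb 2) (eb 1)"

text \<open>The abelian Lie algebra \<open>\<real>\<^sup>3\<close> is cosymplectic; a classification of the remaining ones must exclude it.\<close>

lemma abelian_cosymplectic:
  "cosymplectic_lie_algebra 1 (\<lambda>x y. 0 :: real ^ 3) (ed 3) (ed2 1 2)"
proof
  have "wedge 1 2 (form1 (ed 3)) (wedge_power 2 (form2 (ed2 1 2)) 1) (\<lambda>i. if i = 0 then eb 3 else if i = 1 then eb 1 else eb 2) \<noteq> 0"
    by (subst wedge_1_2_form) (simp_all add: ed2_def ed_def axis_def)
  then show "wedge 1 (2 * 1) (form1 (ed 3)) (wedge_power 2 (form2 (ed2 1 2)) 1) \<noteq> (\<lambda>v. 0)"
    by auto
qed (auto simp: bilinear_def ed_def ed2_def algebra_simps dim_UNIV[where 'a="real^3", simplified] intro!: linearI)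

end

theory Submission imports Defs begin

text \<open>
  Let \<open>\<xi>\<close> be the Reeb vector, \<open>\<alpha> \<xi> = 1\<close> and \<open>\<omega>(\<xi>, \<cdot>) = 0\<close>, and let \<open>H = ker \<alpha>\<close>, an ideal of dimension
  2 on which \<open>\<omega>\<close> is symplectic. Since \<open>\<omega>\<close> is closed, \<open>D = ad \<xi>\<close> acts on \<open>H\<close> as an element of
  \<open>\<ss>\<pp>(2) = \<ss>\<ll>(2)\<close>, that is, \<open>(a, b) \<mapsto> \<omega>(D a, b)\<close> is symmetric. There is \<open>h\<close> in \<open>H\<close> with
  \<open>[a, b] = \<omega>(a, b) h\<close> on \<open>H\<close>, and \<open>D h = tr(D) h = 0\<close>.
  If \<open>h \<noteq> 0\<close>, correcting \<open>\<xi>\<close> by a multiple of \<open>h\<close> makes it central, which gives \<open>\<gg>\<^sub>2\<^sub>.\<^sub>1 \<oplus> \<gg>\<^sub>1\<close>.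
  If \<open>h = 0\<close>, then \<open>D \<noteq> 0\<close> and there is \<open>a\<close> with \<open>\<omega>(D a, a) \<noteq> 0\<close>, so that \<open>a\<close> and \<open>D a\<close> are a basis of
  \<open>H\<close>, in which \<open>D (D a) = \<lambda> a\<close>. The sign of \<open>\<lambda>\<close> separates the remaining three algebras.
\<close>

section \<open>Volume form and coordinates in a basis\<close>

locale cosymplectic_lie_algebra_3 = cosymplectic_lie_algebra 1 br \<alpha> \<omega>
  for br :: "'g::real_vector \<Rightarrow> 'g \<Rightarrow> 'g" and \<alpha> :: "'g \<Rightarrow> real" and \<omega> :: "'g \<Rightarrow> 'g \<Rightarrow> real"
begin

lemmas \<alpha>_simps = linear_add[OF \<alpha>_linear] linear_diff[OF \<alpha>_linear] linear_neg[OF \<alpha>_linear]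
  linear_cmul[OF \<alpha>_linear] linear_0[OF \<alpha>_linear]

lemmas \<omega>_simps = bilinear_ladd[OF \<omega>_bilinear] bilinear_radd[OF \<omega>_bilinear]
  bilinear_lsub[OF \<omega>_bilinear] bilinear_rsub[OF \<omega>_bilinear]
  bilinear_lneg[OF \<omega>_bilinear] bilinear_rneg[OF \<omega>_bilinear]
  bilinear_lmul[OF \<omega>_bilinear] bilinear_rmul[OF \<omega>_bilinear]
  bilinear_lzero[OF \<omega>_bilinear] bilinear_rzero[OF \<omega>_bilinear] \<omega>_alternating

lemmas br_simps = bilinear_ladd[OF br_bilinear] bilinear_radd[OF br_bilinear]
  bilinear_lsub[OF br_bilinear] bilinear_rsub[OF br_bilinear]
  bilinear_lneg[OF br_bilinear] bilinear_rneg[OF br_bilinear]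
  bilinear_lmul[OF br_bilinear] bilinear_rmul[OF br_bilinear]
  bilinear_lzero[OF br_bilinear] bilinear_rzero[OF br_bilinear] br_alternating

lemma \<omega>_skew: "\<omega> y x = - \<omega> x y"
proof -
  have "\<omega> (x + y) (x + y) = 0" by (rule \<omega>_alternating)
  then show ?thesis by (simp only: \<omega>_simps(1,2)) (simp add: \<omega>_alternating)
qed

lemma br_skew: "br y x = - br x y"
proof -
  have "br (x + y) (x + y) = 0" by (rule br_alternating)
  then have "br y x + br x y = 0" by (simp only: br_simps(1,2)) (simp add: br_alternating)
  then show ?thesis by (rule eq_neg_iff_add_eq_0[THEN iffD2])
qed

text \<open>The value of the top form \<alpha> \<and> \<omega> on three vectors, as expanded in
  \<open>wedge_1_2_form\<close>; a nonzero value certifies a basis.\<close>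

definition vol :: "'g \<Rightarrow> 'g \<Rightarrow> 'g \<Rightarrow> real" where
  "vol x y z = \<alpha> x * \<omega> y z + \<alpha> y * \<omega> z x + \<alpha> z * \<omega> x y"

lemma vol_nonzero: "\<exists>x y z. vol x y z \<noteq> 0"
proof -
  from nondegenerate obtain v
    where "wedge 1 (2 * 1) (form1 \<alpha>) (wedge_power 2 (form2 \<omega>) 1) v \<noteq> 0" by auto
  then have "vol (v 0) (v 1) (v 2) \<noteq> 0"
    using wedge_1_2_form[of \<omega> \<alpha> v, OF \<omega>_skew] by (simp add: vol_def)
  then show ?thesis by blast
qed

context
  fixes a b c :: 'g
  assumes vol: "vol a b c \<noteq> 0"
begin

text \<open>Cramer's rule: \<open>vol\<close> is trilinear and alternating, so terms with a repeated
  argument drop out and one coordinate survives.\<close>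

lemma vol_lincomb:
  "vol (p *\<^sub>R a + q *\<^sub>R b + r *\<^sub>R c) b c = p * vol a b c"
  "vol a (p *\<^sub>R a + q *\<^sub>R b + r *\<^sub>R c) c = q * vol a b c"
  "vol a b (p *\<^sub>R a + q *\<^sub>R b + r *\<^sub>R c) = r * vol a b c"
  using \<omega>_skew[of a b] \<omega>_skew[of b c] \<omega>_skew[of a c]
  by (simp_all add: vol_def \<alpha>_simps \<omega>_simps algebra_simps)

lemma lincomb_eq_iff:
  "p *\<^sub>R a + q *\<^sub>R b + r *\<^sub>R c = p' *\<^sub>R a + q' *\<^sub>R b + r' *\<^sub>R c \<longleftrightarrow> p = p' \<and> q = q' \<and> r = r'"
  using vol_lincomb[of p q r] vol_lincomb[of p' q' r'] vol by auto

lemma basis_coordinates: "\<exists>p q r. z = p *\<^sub>R a + q *\<^sub>R b + r *\<^sub>R c"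
proof -
  have ne: "a \<noteq> b" "a \<noteq> c" "b \<noteq> c"
    using lincomb_eq_iff[of 1 0 0 0 1 0] lincomb_eq_iff[of 1 0 0 0 0 1]
      lincomb_eq_iff[of 0 1 0 0 0 1] by auto
  have ind: "independent {a, b, c}"
  proof (rule independent_if_scalars_zero)
    fix f x assume *: "(\<Sum>x\<in>{a, b, c}. f x *\<^sub>R x) = 0" and "x \<in> {a, b, c}"
    from * ne have "f a *\<^sub>R a + f b *\<^sub>R b + f c *\<^sub>R c = 0 *\<^sub>R a + 0 *\<^sub>R b + 0 *\<^sub>R c"
      by (simp add: add.assoc)
    then have "f a = 0" "f b = 0" "f c = 0" by (simp_all only: lincomb_eq_iff)
    then show "f x = 0" using \<open>x \<in> _\<close> by auto
  qed simp
  obtain B :: "'g set" where B: "independent B" "UNIV \<subseteq> span B" "card B = dim (UNIV :: 'g set)"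
    by (rule basis_exists[of "UNIV :: 'g set"]) blast
  then have "card B = 3" using dim_eq by simp
  \<comment> \<open>An infinite set has \<open>card\<close> equal to 0, so the cardinality 3 forces
    finiteness.\<close>
  then have "finite B" by (metis card.infinite zero_neq_numeral)
  have "z \<in> span {a, b, c}"
  proof (rule ccontr)
    assume z: "z \<notin> span {a, b, c}"
    then have "independent (insert z {a, b, c})" using ind by (simp add: independent_insert)
    then have "card (insert z {a, b, c}) \<le> card B"
      using independent_span_bound[OF \<open>finite B\<close>] B(2) by blast
    moreover have "z \<notin> {a, b, c}" using z span_base[of z "{a, b, c}"] by argo
    ultimately show False using ne \<open>card B = 3\<close> by simp
  qed
  then obtain p q r where "z - p *\<^sub>R a - q *\<^sub>R b - r *\<^sub>R c = 0"
    by (auto simp: span_breakdown_eq)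
  then have "z = p *\<^sub>R a + q *\<^sub>R b + r *\<^sub>R c" by (simp add: algebra_simps)
  then show ?thesis by blast
qed

text \<open>Reduces the classification to the choice of a basis: the coordinate map carries the
  bracket to its structure constants and the forms to their values on the basis.\<close>

lemma cosymplectic_isomorphic_bracket3:
  assumes "br a b = u$1 *\<^sub>R a + u$2 *\<^sub>R b + u$3 *\<^sub>R c"
    and "br a c = v$1 *\<^sub>R a + v$2 *\<^sub>R b + v$3 *\<^sub>R c"
    and "br b c = w$1 *\<^sub>R a + w$2 *\<^sub>R b + w$3 *\<^sub>R c"
  shows "cosymplectic_isomorphic br \<alpha> \<omega> (bracket3 u v w)
    (\<lambda>x. \<alpha> a * ed 1 x + \<alpha> b * ed 2 x + \<alpha> c * ed 3 x)
    (\<lambda>x y. \<omega> a b * ed2 1 2 x y + \<omega> a c * ed2 1 3 x y + \<omega> b c * ed2 2 3 x y)"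
proof -
  define \<psi> :: "real ^ 3 \<Rightarrow> 'g" where "\<psi> x = x$1 *\<^sub>R a + x$2 *\<^sub>R b + x$3 *\<^sub>R c" for x
  have lin: "linear \<psi>"
    by (rule linearI) (simp_all add: \<psi>_def algebra_simps)
  have "inj \<psi>"
    by (auto simp: inj_on_def \<psi>_def lincomb_eq_iff vec_eq_iff forall_3)
  moreover have "\<exists>x. z = \<psi> x" for z
  proof -
    obtain p q r where "z = p *\<^sub>R a + q *\<^sub>R b + r *\<^sub>R c" using basis_coordinates by blast
    then have "z = \<psi> (vector [p, q, r])" by (simp add: \<psi>_def)
    then show ?thesis by blast
  qed
  ultimately have bij: "bij \<psi>" by (simp add: bij_def surj_def)
  have \<psi>_inv: "\<psi> (inv \<psi> x) = x" and inv_\<psi>: "inv \<psi> (\<psi> y) = y" for x y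
    using bij by (simp_all add: bij_is_surj surj_f_inv_f bij_is_inj)
  have br_\<psi>: "br (\<psi> x) (\<psi> y) = \<psi> (bracket3 u v w x y)" for x y
  proof -
    have "br (\<psi> x) (\<psi> y) = ed2 1 2 x y *\<^sub>R br a b + ed2 1 3 x y *\<^sub>R br a c + ed2 2 3 x y *\<^sub>R br b c"
      using br_skew[of a b] br_skew[of a c] br_skew[of b c]
      by (simp add: \<psi>_def br_simps ed2_def ed_def algebra_simps)
    also have "\<dots> = ed2 1 2 x y *\<^sub>R \<psi> u + ed2 1 3 x y *\<^sub>R \<psi> v + ed2 2 3 x y *\<^sub>R \<psi> w"
      by (simp only: assms \<psi>_def)
    also have "\<dots> = \<psi> (bracket3 u v w x y)"
      by (simp add: bracket3_def linear_add[OF lin] linear_cmul[OF lin])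
    finally show ?thesis .
  qed
  have \<alpha>_\<psi>: "\<alpha> (\<psi> x) = \<alpha> a * ed 1 x + \<alpha> b * ed 2 x + \<alpha> c * ed 3 x" for x
    by (simp add: \<psi>_def \<alpha>_simps ed_def)
  have \<omega>_\<psi>: "\<omega> (\<psi> x) (\<psi> y)
      = \<omega> a b * ed2 1 2 x y + \<omega> a c * ed2 1 3 x y + \<omega> b c * ed2 2 3 x y" for x y
    using \<omega>_skew[of a b] \<omega>_skew[of a c] \<omega>_skew[of b c]
    by (simp add: \<psi>_def \<omega>_simps ed2_def ed_def algebra_simps)
  \<comment> \<open>The equations for \<open>inv \<psi>\<close> are checked after applying the
    injective map \<open>\<psi>\<close>.\<close>
  have "linear (inv \<psi>)"
    by (rule linearI; rule injD[OF bij_is_inj[OF bij]])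
      (simp_all add: \<psi>_inv linear_add[OF lin] linear_cmul[OF lin])
  then have "lie_iso br (bracket3 u v w) (inv \<psi>)"
    unfolding lie_iso_def using bij_imp_bij_inv[OF bij]
    by (simp add: br_\<psi>[of "inv \<psi> x" "inv \<psi> y" for x y, unfolded \<psi>_inv] inv_\<psi>)
  then show ?thesis
    unfolding cosymplectic_isomorphic_def
    by (intro exI[of _ "inv \<psi>"] conjI allI)
      (simp_all only: \<alpha>_\<psi>[symmetric] \<omega>_\<psi>[symmetric] \<psi>_inv)
qed

end

section \<open>The Reeb vector and the kernel of \<alpha>\<close>

lemma reeb_vector: "\<exists>\<xi>. \<alpha> \<xi> = 1 \<and> (\<forall>z. \<omega> \<xi> z = 0)"
proof -
  obtain a b c where vol: "vol a b c \<noteq> 0" using vol_nonzero by blast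
  \<comment> \<open>The combination in the second factor spans the radical of \<omega>, as the cross
    product does for a skew matrix of size 3. Its value under \<alpha> is \<open>vol a b c\<close>,
    whence the scaling.\<close>
  define \<xi> where "\<xi> = (1 / vol a b c) *\<^sub>R (\<omega> b c *\<^sub>R a + \<omega> c a *\<^sub>R b + \<omega> a b *\<^sub>R c)"
  have "\<alpha> \<xi> * vol a b c = vol a b c"
    using vol by (simp add: \<xi>_def \<alpha>_simps) (simp add: vol_def algebra_simps)
  then have "\<alpha> \<xi> = 1" using vol by simp
  moreover have "\<omega> \<xi> z = 0" for z
  proof -
    obtain p q r where "z = p *\<^sub>R a + q *\<^sub>R b + r *\<^sub>R c"
      using basis_coordinates[OF vol] by blast
    then show ?thesis
      using \<omega>_skew[of a b] \<omega>_skew[of a c] \<omega>_skew[of b c]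
      by (simp add: \<xi>_def \<omega>_simps algebra_simps)
  qed
  ultimately show ?thesis by blast
qed

end

locale cosymplectic_reeb = cosymplectic_lie_algebra_3 +
  fixes \<xi> :: 'a
  assumes \<alpha>_reeb: "\<alpha> \<xi> = 1"
    and \<omega>_reeb: "\<omega> \<xi> z = 0"
begin

lemma \<omega>_reeb': "\<omega> z \<xi> = 0"
  using \<omega>_skew[of \<xi> z] \<omega>_reeb by simp

lemma vol_reeb: "\<alpha> a = 0 \<Longrightarrow> \<alpha> b = 0 \<Longrightarrow> vol a b \<xi> = \<omega> a b"
  by (simp add: vol_def \<alpha>_reeb)

text \<open>The third coordinate in the basis \<open>a\<close>, \<open>b\<close>,
  \<open>\<xi>\<close> is \<open>\<alpha> z\<close>, hence 0; pairing with \<open>b\<close> and with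
  \<open>a\<close> reads off the other two.\<close>

lemma kernel_decomposition:
  assumes "\<alpha> a = 0" "\<alpha> b = 0" "\<alpha> z = 0" "\<omega> a b \<noteq> 0"
  shows "\<omega> a b *\<^sub>R z = \<omega> z b *\<^sub>R a + \<omega> a z *\<^sub>R b"
proof -
  obtain p q r where z: "z = p *\<^sub>R a + q *\<^sub>R b + r *\<^sub>R \<xi>"
    using basis_coordinates[of a b \<xi> z] vol_reeb[of a b] assms by metis
  then have "r = 0" using assms by (simp add: \<alpha>_simps \<alpha>_reeb)
  then show ?thesis by (simp add: z \<omega>_simps algebra_simps)
qed

text \<open>Projecting along \<open>\<xi>\<close> onto the kernel leaves \<omega> unchanged, because
  \<open>\<xi>\<close> lies in its radical.\<close>

lemma kernel_symplectic_pair: "\<exists>x y. \<alpha> x = 0 \<and> \<alpha> y = 0 \<and> \<omega> x y = 1"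
proof -
  obtain a b c where "vol a b c \<noteq> 0" using vol_nonzero by blast
  then have "\<omega> b c \<noteq> 0 \<or> \<omega> c a \<noteq> 0 \<or> \<omega> a b \<noteq> 0" by (auto simp: vol_def)
  then obtain a b where ab: "\<omega> a b \<noteq> 0" by blast
  define x where "x = (1 / \<omega> a b) *\<^sub>R (a - \<alpha> a *\<^sub>R \<xi>)"
  define y where "y = b - \<alpha> b *\<^sub>R \<xi>"
  have "\<alpha> x = 0" "\<alpha> y = 0" "\<omega> x y = 1"
    using ab by (simp_all add: x_def y_def \<alpha>_simps \<omega>_simps \<alpha>_reeb \<omega>_reeb \<omega>_reeb')
  then show ?thesis by blast
qed

lemma kernel_nondegenerate:
  assumes "\<alpha> a = 0" "a \<noteq> 0"
  shows "\<exists>b. \<alpha> b = 0 \<and> \<omega> a b = 1"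
proof -
  obtain x y where xy: "\<alpha> x = 0" "\<alpha> y = 0" "\<omega> x y = 1" using kernel_symplectic_pair by blast
  have "a = \<omega> a y *\<^sub>R x + \<omega> x a *\<^sub>R y"
    using kernel_decomposition[OF xy(1,2) assms(1)] xy(3) by simp
  then have "\<omega> a y \<noteq> 0 \<or> \<omega> a x \<noteq> 0" using \<omega>_skew[of a x] assms(2) by auto
  then obtain b where b: "\<alpha> b = 0" "\<omega> a b \<noteq> 0" using xy by blast
  then show ?thesis
    by (intro exI[of _ "(1 / \<omega> a b) *\<^sub>R b"]) (simp add: \<alpha>_simps \<omega>_simps)
qed

text \<open>In the closedness identity for \<open>a\<close>, \<open>b\<close>, \<open>\<xi>\<close>
  the term \<open>\<omega> (br a b) \<xi>\<close> vanishes.\<close>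

lemma ad_reeb_symmetric: "\<omega> (br \<xi> a) b = \<omega> (br \<xi> b) a"
  using \<omega>_closed[of a b \<xi>] br_skew[of \<xi> b] by (simp add: \<omega>_reeb' \<omega>_simps)

text \<open>On a plane every alternating bilinear map is \<omega> times a fixed vector, here
  \<open>br x y\<close> for a symplectic pair.\<close>

lemma kernel_bracket:
  "\<exists>h. \<alpha> h = 0 \<and> br \<xi> h = 0 \<and> (\<forall>a b. \<alpha> a = 0 \<longrightarrow> \<alpha> b = 0 \<longrightarrow> br a b = \<omega> a b *\<^sub>R h)"
proof -
  obtain x y where xy: "\<alpha> x = 0" "\<alpha> y = 0" "\<omega> x y = 1" using kernel_symplectic_pair by blast
  have br_h: "br a b = \<omega> a b *\<^sub>R br x y" if "\<alpha> a = 0" "\<alpha> b = 0" for a b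
  proof -
    have a: "a = \<omega> a y *\<^sub>R x + \<omega> x a *\<^sub>R y" and b: "b = \<omega> b y *\<^sub>R x + \<omega> x b *\<^sub>R y"
      using kernel_decomposition[OF xy(1,2)] xy(3) that by simp_all
    have "br a b = br (\<omega> a y *\<^sub>R x + \<omega> x a *\<^sub>R y) (\<omega> b y *\<^sub>R x + \<omega> x b *\<^sub>R y)"
      by (rule arg_cong2[OF a b])
    also have "\<dots> = (\<omega> a y * \<omega> x b - \<omega> x a * \<omega> b y) *\<^sub>R br x y"
      by (simp add: br_simps br_skew[of x y] algebra_simps)
    finally have "br a b = (\<omega> a y * \<omega> x b - \<omega> x a * \<omega> b y) *\<^sub>R br x y" .
    moreover have "\<omega> a b = \<omega> (\<omega> a y *\<^sub>R x + \<omega> x a *\<^sub>R y) (\<omega> b y *\<^sub>R x + \<omega> x b *\<^sub>R y)"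
      by (rule arg_cong2[OF a b])
    then have "\<omega> a b = \<omega> a y * \<omega> x b - \<omega> x a * \<omega> b y"
      by (simp add: \<omega>_simps \<omega>_skew[of y x] xy(3) algebra_simps)
    ultimately show ?thesis by simp
  qed
  have "br \<xi> (br x y) = br x (br \<xi> y) - br y (br \<xi> x)"
    using br_jacobi[of \<xi> x y] br_skew[of y \<xi>] by (simp add: br_simps algebra_simps)
  \<comment> \<open>The coefficient is the trace of \<open>br \<xi>\<close> on the kernel in the
    basis \<open>x\<close>, \<open>y\<close>; symmetry makes it vanish.\<close>
  also have "\<dots> = (\<omega> x (br \<xi> y) - \<omega> y (br \<xi> x)) *\<^sub>R br x y"
    using br_h[of x "br \<xi> y"] br_h[of y "br \<xi> x"] by (simp add: xy \<alpha>_closed algebra_simps)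
  also have "\<dots> = 0"
    using ad_reeb_symmetric[of x y] \<omega>_skew[of x "br \<xi> y"] \<omega>_skew[of y "br \<xi> x"] by simp
  finally show ?thesis using br_h \<alpha>_closed by blast
qed

section \<open>Normal forms of the bracket\<close>

lemma isomorphic_g21_g1:
  assumes h: "\<alpha> h = 0" "br \<xi> h = 0" "h \<noteq> 0"
    and br_h: "\<And>a b. \<alpha> a = 0 \<Longrightarrow> \<alpha> b = 0 \<Longrightarrow> br a b = \<omega> a b *\<^sub>R h"
  shows "\<exists>a3 a12 a23. a3 * a12 \<noteq> 0 \<and>
    cosymplectic_isomorphic br \<alpha> \<omega> g21_g1 (\<lambda>x. a3 * ed 3 x)
      (\<lambda>x y. a12 * ed2 1 2 x y + a23 * ed2 2 3 x y)"
proof -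
  obtain k where k: "\<alpha> k = 0" "\<omega> h k = 1" using kernel_nondegenerate h by blast
  define c where "c = \<omega> (br \<xi> k) k"
  \<comment> \<open>The \<open>k\<close>-coordinate of \<open>br \<xi> k\<close> is
    \<open>\<omega> h (br \<xi> k)\<close>, which by symmetry is
    \<open>- \<omega> (br \<xi> h) k = 0\<close>.\<close>
  have Dk: "br \<xi> k = c *\<^sub>R h"
    using kernel_decomposition[of h k "br \<xi> k"] k h \<omega>_skew[of h "br \<xi> k"]
      ad_reeb_symmetric[of k h] by (simp add: \<alpha>_closed \<omega>_simps c_def)
  \<comment> \<open>Since \<open>br h k = h\<close>, subtracting \<open>c *\<^sub>R h\<close>
    cancels \<open>br \<xi> k\<close> and keeps \<open>br \<xi> h = 0\<close>. The price is
    \<open>\<omega> k e = c\<close>, the coefficient of \<open>ed2 2 3\<close>.\<close>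
  define e where "e = \<xi> - c *\<^sub>R h"
  have \<omega>e: "\<omega> h k = 1" "\<omega> h e = 0" "\<alpha> e = 1"
    using k h by (simp_all add: e_def \<omega>_simps \<alpha>_simps \<omega>_reeb' \<alpha>_reeb)
  have vol: "vol h k e \<noteq> 0" using h k \<omega>e by (simp add: vol_def)
  have "br h k = h" using br_h h k by simp
  moreover have "br h e = 0" using h br_skew[of \<xi> h] by (simp add: e_def br_simps)
  moreover have "br k e = 0"
    using \<open>br h k = h\<close> by (simp add: e_def br_simps br_skew[of k] Dk)
  ultimately have "cosymplectic_isomorphic br \<alpha> \<omega> (bracket3 (eb 1) 0 0)
      (\<lambda>x. \<alpha> h * ed 1 x + \<alpha> k * ed 2 x + \<alpha> e * ed 3 x)
      (\<lambda>x y. \<omega> h k * ed2 1 2 x y + \<omega> h e * ed2 1 3 x y + \<omega> k e * ed2 2 3 x y)"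
    by (intro cosymplectic_isomorphic_bracket3 vol) (simp_all add: axis_def)
  then show ?thesis
    using h k \<omega>e unfolding g21_g1_def
    by (intro exI[of _ "\<alpha> e"] exI[of _ "\<omega> h k"] exI[of _ "\<omega> k e"]) simp
qed

text \<open>Common last step for an abelian kernel, with basis \<open>a\<close>, \<open>b\<close>,
  \<open>t *\<^sub>R \<xi>\<close>. The factor \<open>t\<close> serves to normalise the action of
  \<open>\<xi>\<close>; \<omega> has no mixed terms because \<open>\<xi>\<close> is in its
  radical.\<close>

lemma isomorphic_abelian_kernel:
  assumes ab: "\<alpha> a = 0" "\<alpha> b = 0" "\<omega> a b \<noteq> 0" and "t \<noteq> 0" and "br a b = 0"
    and "t *\<^sub>R br a \<xi> = v$1 *\<^sub>R a + v$2 *\<^sub>R b" "v$3 = 0"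
    and "t *\<^sub>R br b \<xi> = w$1 *\<^sub>R a + w$2 *\<^sub>R b" "w$3 = 0"
  shows "t * \<omega> a b \<noteq> 0 \<and> cosymplectic_isomorphic br \<alpha> \<omega> (bracket3 0 v w) (\<lambda>x. t * ed 3 x)
    (\<lambda>x y. \<omega> a b * ed2 1 2 x y)"
proof -
  have vol: "vol a b (t *\<^sub>R \<xi>) \<noteq> 0"
    using ab \<open>t \<noteq> 0\<close> by (simp add: vol_def \<alpha>_simps \<alpha>_reeb)
  have "cosymplectic_isomorphic br \<alpha> \<omega> (bracket3 0 v w)
      (\<lambda>x. \<alpha> a * ed 1 x + \<alpha> b * ed 2 x + \<alpha> (t *\<^sub>R \<xi>) * ed 3 x)
      (\<lambda>x y. \<omega> a b * ed2 1 2 x y + \<omega> a (t *\<^sub>R \<xi>) * ed2 1 3 x y + \<omega> b (t *\<^sub>R \<xi>) * ed2 2 3 x y)"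
    using assms by (intro cosymplectic_isomorphic_bracket3 vol) (simp_all add: br_simps)
  then show ?thesis
    using ab \<open>t \<noteq> 0\<close> by (simp add: \<alpha>_simps \<omega>_simps \<alpha>_reeb \<omega>_reeb')
qed

lemma ad_reeb_nonzero:
  assumes ker: "\<And>a b. \<alpha> a = 0 \<Longrightarrow> \<alpha> b = 0 \<Longrightarrow> br a b = 0"
    and "\<not> abelian_bracket br"
  shows "\<exists>a. \<alpha> a = 0 \<and> \<omega> (br \<xi> a) a \<noteq> 0"
proof (rule ccontr)
  assume "\<not> ?thesis"
  then have q: "\<omega> (br \<xi> a) a = 0" if "\<alpha> a = 0" for a using that by blast
  \<comment> \<open>Polarisation: a symmetric bilinear form is zero when its quadratic form
    is.\<close>
  have "\<omega> (br \<xi> a) b = 0" if "\<alpha> a = 0" "\<alpha> b = 0" for a b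
    using q[of "a + b"] q[of a] q[of b] that ad_reeb_symmetric[of a b]
    by (simp add: \<alpha>_simps br_simps \<omega>_simps)
  then have D: "br \<xi> a = 0" if "\<alpha> a = 0" for a
    using kernel_nondegenerate[of "br \<xi> a"] that \<alpha>_closed by fastforce
  have "br x y = 0" for x y
  proof -
    define x' y' where "x' = x - \<alpha> x *\<^sub>R \<xi>" and "y' = y - \<alpha> y *\<^sub>R \<xi>"
    have "\<alpha> x' = 0" "\<alpha> y' = 0" by (simp_all add: x'_def y'_def \<alpha>_simps \<alpha>_reeb)
    then have "br x' y' = 0" "br \<xi> x' = 0" "br \<xi> y' = 0" "br x' \<xi> = 0"
      using ker D br_skew[of \<xi> x'] by simp_all
    moreover have "x = x' + \<alpha> x *\<^sub>R \<xi>" "y = y' + \<alpha> y *\<^sub>R \<xi>" by (simp_all add: x'_def y'_def)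
    ultimately show ?thesis by (metis add_0 br_simps(1,2,7,8) br_alternating scale_zero_right)
  qed
  then show False using assms(2) by (simp add: abelian_bracket_def)
qed

lemma abelian_kernel_cases:
  assumes ker: "\<And>a b. \<alpha> a = 0 \<Longrightarrow> \<alpha> b = 0 \<Longrightarrow> br a b = 0"
    and "\<not> abelian_bracket br"
  shows "\<exists>t a12 G. G \<in> {g31, g34, g35} \<and> t * a12 \<noteq> 0 \<and>
    cosymplectic_isomorphic br \<alpha> \<omega> G (\<lambda>x. t * ed 3 x) (\<lambda>x y. a12 * ed2 1 2 x y)"
proof -
  obtain a where a: "\<alpha> a = 0" "\<omega> (br \<xi> a) a \<noteq> 0" using ad_reeb_nonzero[OF assms] by blast
  define d where "d = br \<xi> a"
  have d: "\<alpha> d = 0" "\<omega> d a \<noteq> 0" "\<omega> a d \<noteq> 0"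
    using a \<alpha>_closed \<omega>_skew[of a d] by (simp_all add: d_def)
  \<comment> \<open>By symmetry this is \<open>\<omega> d d\<close>. Hence \<open>br \<xi> d\<close>
    has no \<open>d\<close>-coordinate and is a multiple of \<open>a\<close>.\<close>
  have "\<omega> (br \<xi> d) a = 0"
    using ad_reeb_symmetric[of d a] \<omega>_alternating by (simp add: d_def)
  then have "\<omega> d a *\<^sub>R br \<xi> d = - \<omega> (br \<xi> d) d *\<^sub>R a"
    using kernel_decomposition[of d a "br \<xi> d"] d a \<alpha>_closed \<omega>_skew[of d "br \<xi> d"] by simp
  from arg_cong[OF this, of "scaleR (1 / \<omega> d a)"]
  have "br \<xi> d = (- \<omega> (br \<xi> d) d / \<omega> d a) *\<^sub>R a"
    using d by simp
  then obtain l where l: "br \<xi> d = l *\<^sub>R a" by blast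
  have br: "br a \<xi> = - d" "br d \<xi> = - l *\<^sub>R a"
    using br_skew[of a \<xi>] br_skew[of d \<xi>] l by (simp_all flip: d_def)
  consider "l = 0" | "l > 0" | "l < 0" by linarith
  then show ?thesis
  proof cases
    case 1
    \<comment> \<open>The ordered basis \<open>- d\<close>, \<open>a\<close>, \<open>\<xi>\<close>
      satisfies \<open>br a \<xi> = - d\<close>, the only nonzero bracket.\<close>
    have "1 * \<omega> (- d) a \<noteq> 0 \<and> cosymplectic_isomorphic br \<alpha> \<omega> g31 (\<lambda>x. 1 * ed 3 x)
        (\<lambda>x y. \<omega> (- d) a * ed2 1 2 x y)"
      unfolding g31_def using a d br 1 ker[of "- d" a]
      by (intro isomorphic_abelian_kernel) (simp_all add: \<alpha>_simps \<omega>_simps br_simps axis_def)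
    then show ?thesis by blast
  next
    case 2
    define s where "s = sqrt l"
    have s: "s > 0" "l = s * s" using 2 by (simp_all add: s_def)
    \<comment> \<open>Eigenvectors of \<open>br \<xi>\<close> for \<open>s\<close> and
      \<open>- s\<close>. Swapping the arguments of the bracket changes the sign, so
      \<open>\<xi>\<close> is scaled by \<open>- 1 / s\<close>.\<close>
    define u v where "u = d + s *\<^sub>R a" and "v = d - s *\<^sub>R a"
    have uv: "\<alpha> u = 0" "\<alpha> v = 0" using a d by (simp_all add: u_def v_def \<alpha>_simps)
    have "\<omega> u v = - 2 * s * \<omega> d a"
      by (simp add: u_def v_def \<omega>_simps \<omega>_skew[of d a])
    then have "\<omega> u v \<noteq> 0" using s d by simp
    moreover have "(- 1 / s) *\<^sub>R br u \<xi> = u" "(- 1 / s) *\<^sub>R br v \<xi> = - v"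
      using s by (simp_all add: u_def v_def br_simps br algebra_simps)
    ultimately have "(- 1 / s) * \<omega> u v \<noteq> 0 \<and>
        cosymplectic_isomorphic br \<alpha> \<omega> g34 (\<lambda>x. (- 1 / s) * ed 3 x) (\<lambda>x y. \<omega> u v * ed2 1 2 x y)"
      unfolding g34_def using s uv ker[of u v]
      by (intro isomorphic_abelian_kernel) (simp_all add: axis_def)
    then show ?thesis by blast
  next
    case 3
    define s where "s = sqrt (- l)"
    have s: "s > 0" "l = - (s * s)" using 3 by (simp_all add: s_def)
    \<comment> \<open>With this scaling \<open>br \<xi>\<close> maps \<open>a\<close> to
      \<open>s *\<^sub>R v\<close> and \<open>v\<close> to \<open>- s *\<^sub>R a\<close>: it is
      \<open>s\<close> times a quarter turn.\<close>
    define v where "v = (1 / s) *\<^sub>R d"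
    have v: "\<alpha> v = 0" "\<omega> a v \<noteq> 0" using d s by (simp_all add: v_def \<alpha>_simps \<omega>_simps)
    moreover have "(1 / s) *\<^sub>R br a \<xi> = - v" "(1 / s) *\<^sub>R br v \<xi> = a"
      using s by (simp_all add: v_def br_simps br)
    ultimately have "(1 / s) * \<omega> a v \<noteq> 0 \<and>
        cosymplectic_isomorphic br \<alpha> \<omega> g35 (\<lambda>x. (1 / s) * ed 3 x) (\<lambda>x y. \<omega> a v * ed2 1 2 x y)"
      unfolding g35_def using s a ker[of a v]
      by (intro isomorphic_abelian_kernel) (simp_all add: axis_def)
    then show ?thesis by blast
  qed
qed

end

theorem proposition4p1:
  fixes br :: "'g::real_vector \<Rightarrow> 'g \<Rightarrow> 'g"
    and \<alpha> :: "'g \<Rightarrow> real"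
    and \<omega> :: "'g \<Rightarrow> 'g \<Rightarrow> real"
  assumes "cosymplectic_lie_algebra 1 br \<alpha> \<omega>"
    and "\<not> abelian_bracket br"
  shows "(\<exists>a2 a3 a12 a23. a3 * a12 \<noteq> 0 \<and>
            cosymplectic_isomorphic br \<alpha> \<omega> g21_g1
              (\<lambda>x. a2 * ed 2 x + a3 * ed 3 x)
              (\<lambda>x y. a12 * ed2 1 2 x y + a23 * ed2 2 3 x y))
       \<or> (\<exists>a2 a3 a12 a13 a23. a3 * a12 - a2 * a13 \<noteq> 0 \<and>
            cosymplectic_isomorphic br \<alpha> \<omega> g31
              (\<lambda>x. a2 * ed 2 x + a3 * ed 3 x)
              (\<lambda>x y. a12 * ed2 1 2 x y + a13 * ed2 1 3 x y + a23 * ed2 2 3 x y))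
       \<or> (\<exists>a3 a12 a13 a23. a3 * a12 \<noteq> 0 \<and>
            cosymplectic_isomorphic br \<alpha> \<omega> g34
              (\<lambda>x. a3 * ed 3 x)
              (\<lambda>x y. a12 * ed2 1 2 x y + a13 * ed2 1 3 x y + a23 * ed2 2 3 x y))
       \<or> (\<exists>a3 a12 a13 a23. a3 * a12 \<noteq> 0 \<and>
            cosymplectic_isomorphic br \<alpha> \<omega> g35
              (\<lambda>x. a3 * ed 3 x)
              (\<lambda>x y. a12 * ed2 1 2 x y + a13 * ed2 1 3 x y + a23 * ed2 2 3 x y))"
proof -
  interpret cosymplectic_lie_algebra_3 br \<alpha> \<omega>
    using assms(1) by (simp add: cosymplectic_lie_algebra_3_def)
  obtain \<xi> where \<xi>: "\<alpha> \<xi> = 1" "\<And>z. \<omega> \<xi> z = 0" using reeb_vector by blast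
  interpret cosymplectic_reeb br \<alpha> \<omega> \<xi> using \<xi> by unfold_locales
  obtain h where h: "\<alpha> h = 0" "br \<xi> h = 0"
    and br_h: "\<And>a b. \<alpha> a = 0 \<Longrightarrow> \<alpha> b = 0 \<Longrightarrow> br a b = \<omega> a b *\<^sub>R h"
    using kernel_bracket by blast
  show ?thesis
  proof (cases "h = 0")
    case True
    then have "\<And>a b. \<alpha> a = 0 \<Longrightarrow> \<alpha> b = 0 \<Longrightarrow> br a b = 0" using br_h by simp
    from abelian_kernel_cases[OF this assms(2)] obtain t a12 G
      where G: "G \<in> {g31, g34, g35}" and ne: "t * a12 \<noteq> 0"
        and iso: "cosymplectic_isomorphic br \<alpha> \<omega> G (\<lambda>x. t * ed 3 x) (\<lambda>x y. a12 * ed2 1 2 x y)"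
      by blast
    \<comment> \<open>Zero coefficients fit the normal form to the listed shapes: the first version,
      with an \<open>ed 2\<close> term, is for \<open>g31\<close>, the second for \<open>g34\<close>
      and \<open>g35\<close>.\<close>
    have "cosymplectic_isomorphic br \<alpha> \<omega> G (\<lambda>x. 0 * ed 2 x + t * ed 3 x)
        (\<lambda>x y. a12 * ed2 1 2 x y + 0 * ed2 1 3 x y + 0 * ed2 2 3 x y)"
      "cosymplectic_isomorphic br \<alpha> \<omega> G (\<lambda>x. t * ed 3 x)
        (\<lambda>x y. a12 * ed2 1 2 x y + 0 * ed2 1 3 x y + 0 * ed2 2 3 x y)"
      "t * a12 - 0 * 0 \<noteq> 0"
      using iso ne by simp_all
    with G ne show ?thesis by blast
  next
    case False
    from isomorphic_g21_g1[OF h False br_h] obtain a3 a12 a23 where ne: "a3 * a12 \<noteq> 0"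
      and iso: "cosymplectic_isomorphic br \<alpha> \<omega> g21_g1 (\<lambda>x. a3 * ed 3 x)
        (\<lambda>x y. a12 * ed2 1 2 x y + a23 * ed2 2 3 x y)" by blast
    have "cosymplectic_isomorphic br \<alpha> \<omega> g21_g1 (\<lambda>x. 0 * ed 2 x + a3 * ed 3 x)
        (\<lambda>x y. a12 * ed2 1 2 x y + a23 * ed2 2 3 x y)"
      using iso by simp
    with ne show ?thesis by blast
  qed
qed

end
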